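(* Let $p \ge 1$, let $\mathcal{G} = (\mathcal{V}, \mathcal{E})$, $\mathcal{V} = [n]$, be a lateration graph in dimension $p$, and let $x_1, \dots, x_n \in \mathbb{R}^p$ be a configuration in general position. Then there are $\sigma > 0$ and $A > 0$ (depending on the graph and on the configuration $x_1, \dots, x_n$) such that the following holds. Let $(d_{ij} : (i,j) \in \mathcal{E})$ be non-negative dissimilarities and write $$d_{ij}^2 = \|x_i - x_j\|^2 + \varepsilon_{ij}, \qquad (i,j) \in \mathcal{E}.$$ If $\sum_{(i,j) \in \mathcal{E}} \varepsilon_{ij}^2 \le \sigma^2$, then any minimizer $y^*_1, \dots, y^*_n \in \mathbb{R}^p$ of the stress $$(y_1, \dots, y_n) \mapsto \sum_{(i,j) \in \mathcal{E}} \big(\|y_i - y_j\|^2 - d_{ij}^2\big)^2$$ over $(\mathbb{R}^p)^n$ satisfies $$\min_{g} \sum_{i \in [n]} \|y^*_i - g(x_i)\|^2 \le A \sum_{(i,j) \in \mathcal{E}} \varepsilon_{ij}^2,$$ where the minimization is over the group of rigid transformations of $\mathbb{R}^p$.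
   Context: Notation: $[n] = \{1, \dots, n\}$; $\|\cdot\|$ is the Euclidean norm on $\mathbb{R}^p$. Graphs are undirected. A rigid transformation is a Euclidean isometry of $\mathbb{R}^p$ (reflections allowed). The dissimilarities are symmetric: $d_{ij} = d_{ji}$. Lateration graph (in dimension $p$): a graph with $n \ge p+1$ vertices that admits an ordering $v_1, \dots, v_n$ of its vertices such that the subgraph induced by $v_1, \dots, v_{p+1}$ is complete and, for each $j > p+1$, $v_j$ is connected to at least $p+1$ vertices among $v_1, \dots, v_{j-1}$. General position: a configuration in $\mathbb{R}^p$ is in general position if any $(p+1)$-tuple of (distinctly indexed) points of it spans the entire space (i.e., its affine span is $\mathbb{R}^p$). *)

theory Defs
  imports "HOL-Analysis.Analysis"
begin

text \<open>
  An undirected edge is stored as both of its orientations, so that \<open>(i, j) \<in> E\<close> is a symmetric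
  relation, matching \<open>d i j = d j i\<close>.
\<close>
definition simple_graph :: "nat \<Rightarrow> (nat \<times> nat) set \<Rightarrow> bool" where
  "simple_graph n E \<longleftrightarrow> E \<subseteq> {1..n} \<times> {1..n} \<and> sym E \<and> irrefl E"

text \<open>One representative for each undirected edge, so that sums count every edge once.\<close>
definition edges :: "(nat \<times> nat) set \<Rightarrow> (nat \<times> nat) set" where
  "edges E = {(i, j). (i, j) \<in> E \<and> i < j}"

definition lateration_graph :: "nat \<Rightarrow> nat \<Rightarrow> (nat \<times> nat) set \<Rightarrow> bool" where
  "lateration_graph p n E \<longleftrightarrow>
     simple_graph n E \<and> p + 1 \<le> n \<and>
     (\<exists>v. bij_betw v {1..n} {1..n} \<and>
        (\<forall>i\<in>{1..p + 1}. \<forall>j\<in>{1..p + 1}. i \<noteq> j \<longrightarrow> (v i, v j) \<in> E) \<and>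
        (\<forall>j\<in>{p + 2..n}. p + 1 \<le> card {u \<in> v ` {1..<j}. (u, v j) \<in> E}))"

text \<open>
  The tuples are indexed by sets of indices rather than by sets of points; in particular,
  coinciding points violate general position.
\<close>
definition general_position :: "nat \<Rightarrow> (nat \<Rightarrow> real ^ 'p) \<Rightarrow> bool" where
  "general_position n x \<longleftrightarrow>
     (\<forall>I \<subseteq> {1..n}. card I = CARD('p) + 1 \<longrightarrow> affine hull (x ` I) = UNIV)"

text \<open>Surjectivity is automatic for an isometry of \<open>real ^ 'p\<close>; reflections are included.\<close>
definition rigid_transformation :: "(real ^ 'p \<Rightarrow> real ^ 'p) \<Rightarrow> bool" where
  "rigid_transformation g \<longleftrightarrow> (\<forall>u v. dist (g u) (g v) = dist u v)"

definition stress ::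
  "(nat \<times> nat) set \<Rightarrow> (nat \<Rightarrow> nat \<Rightarrow> real) \<Rightarrow> (nat \<Rightarrow> real ^ 'p) \<Rightarrow> real" where
  "stress E d y = (\<Sum>(i, j)\<in>edges E. ((norm (y i - y j))\<^sup>2 - (d i j)\<^sup>2)\<^sup>2)"

definition alignment_error ::
  "nat \<Rightarrow> (nat \<Rightarrow> real ^ 'p) \<Rightarrow> (nat \<Rightarrow> real ^ 'p) \<Rightarrow> (real ^ 'p \<Rightarrow> real ^ 'p) \<Rightarrow> real" where
  "alignment_error n x y g = (\<Sum>i\<in>{1..n}. (norm (y i - g (x i)))\<^sup>2)"

end

theory Submission
  imports Defs
begin

text \<open>
  A minimizer \<open>y\<close> has stress at most that of the true configuration \<open>x\<close>, which is
  \<open>\<eta>\<^sup>2 = \<Sum> \<epsilon>\<^sup>2\<close>. Hence along each edge the squared length in \<open>y\<close> is within \<open>\<eta>\<close> of \<open>d\<^sup>2\<close>,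
  which is itself within \<open>\<eta>\<close> of the squared length in \<open>x\<close>
  (\<open>stress_minimizer_edge_lengths\<close>). What remains is a stability statement:
  a configuration whose squared edge lengths are \<open>\<delta>\<close>-close to those of \<open>x\<close> is \<open>O(\<delta>)\<close>-close to a rigid copy of \<open>x\<close>, provided \<open>\<delta>\<close> is small
  (\<open>lateration_graph_alignment\<close>). Squaring and summing over the vertices then gives the bound
  \<open>A \<eta>\<^sup>2\<close>, first for one particular rigid transformation and hence for an optimal one.

  Stability is proved along the lateration ordering. The first \<open>p + 1\<close> points form a complete
  simplex, so all inner products of its difference vectors are known up to \<open>O(\<delta>)\<close>. The linear map
  carrying the differences in \<open>x\<close> to those in \<open>y\<close> therefore sends the standard basis to a
  family whose Gram matrix is \<open>O(\<delta>)\<close>-close to the identity, and Gram-Schmidt moves such a family only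
  by \<open>O(\<delta>)\<close> to an orthonormal one (\<open>near_orthonormal_family\<close>). This yields a rigid transformation
  aligning the simplex with a \<^emph>\<open>linear\<close> error (\<open>base_simplex_alignment\<close>). Every further
  point is placed relative to \<open>p + 1\<close> earlier, already aligned points in general position.
  Subtracting two of its squared distances cancels the quadratic term, so the error satisfies a
  nonsingular linear system with right-hand side \<open>O(\<delta>)\<close> (\<open>lateration_step\<close>).

  Smallness of \<open>\<delta>\<close> serves two purposes: it keeps the vectors in the Gram-Schmidt process away from
  zero, and it turns the quadratic terms in \<open>\<delta>\<close> of the lateration step into linear ones. That an
  optimal rigid transformation exists is a compactness argument (\<open>minimal_alignment_exists\<close>).
\<close>

section \<open>Quantitative linear algebra\<close>

text \<open>
  A spanning set is a nonsingular system of linear equations: writing each basis vector in terms of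
  \<open>S\<close> recovers the coordinates of \<open>z\<close> from its inner products with \<open>S\<close>, and the
  coefficients give the constant.
\<close>
lemma norm_le_of_inner_spanning:
  fixes S :: "'a::euclidean_space set"
  assumes "finite S" and "span S = UNIV"
  shows "\<exists>K\<ge>0. \<forall>z B. 0 \<le> B \<longrightarrow> (\<forall>u\<in>S. \<bar>z \<bullet> u\<bar> \<le> B) \<longrightarrow> norm z \<le> K * B"
proof -
  have "\<exists>c. e = (\<Sum>u\<in>S. c u *\<^sub>R u)" for e :: 'a
  proof -
    have "e \<in> span S" using assms(2) by simp
    then show ?thesis by (auto simp: span_finite[OF assms(1)])
  qed
  then obtain c where c: "\<And>e :: 'a. e = (\<Sum>u\<in>S. c e u *\<^sub>R u)" by metis
  define K where "K = (\<Sum>e\<in>(Basis :: 'a set). \<Sum>u\<in>S. \<bar>c e u\<bar>)"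
  have "norm z \<le> K * B" if B: "0 \<le> B" "\<forall>u\<in>S. \<bar>z \<bullet> u\<bar> \<le> B" for z B
  proof -
    have "\<bar>z \<bullet> e\<bar> \<le> (\<Sum>u\<in>S. \<bar>c e u\<bar>) * B" for e
    proof -
      have "z \<bullet> e = z \<bullet> (\<Sum>u\<in>S. c e u *\<^sub>R u)" using c[of e] by simp
      also have "\<dots> = (\<Sum>u\<in>S. c e u * (z \<bullet> u))" by (simp add: inner_sum_right)
      finally have "\<bar>z \<bullet> e\<bar> \<le> (\<Sum>u\<in>S. \<bar>c e u * (z \<bullet> u)\<bar>)" by simp
      also have "\<dots> \<le> (\<Sum>u\<in>S. \<bar>c e u\<bar> * B)"
        using B by (intro sum_mono) (simp add: abs_mult mult_left_mono)
      finally show ?thesis by (simp add: sum_distrib_right)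
    qed
    then have "(\<Sum>e\<in>Basis. \<bar>z \<bullet> e\<bar>) \<le> K * B"
      unfolding K_def sum_distrib_right[of _ _ B] by (intro sum_mono) (simp add: sum_distrib_right)
    then show ?thesis using norm_le_l1[of z] by linarith
  qed
  moreover have "0 \<le> K" unfolding K_def by (intro sum_nonneg) simp
  ultimately show ?thesis by blast
qed

text \<open>
  Gram-Schmidt. Subtracting from the next vector its components along the previous, already
  orthonormalized ones changes it by \<open>O(\<delta>)\<close>, because these components are nearly the given inner
  products. The result has length \<open>1 + O(\<delta>)\<close>, so normalizing it costs another \<open>O(\<delta>)\<close>. The constants
  depend only on the size of \<open>J\<close>.
\<close>
lemma near_orthonormal_family:
  fixes J :: "'i set"
  assumes "finite J"
  shows "\<exists>C\<ge>0. \<exists>s>0. \<forall>\<delta> (b :: 'i \<Rightarrow> 'a::real_inner). 0 \<le> \<delta> \<longrightarrow> \<delta> \<le> s \<longrightarrow>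
    (\<forall>i\<in>J. \<forall>j\<in>J. \<bar>b i \<bullet> b j - (if i = j then 1 else 0)\<bar> \<le> \<delta>) \<longrightarrow>
    (\<exists>q. (\<forall>i\<in>J. \<forall>j\<in>J. q i \<bullet> q j = (if i = j then 1 else 0)) \<and>
         (\<forall>i\<in>J. norm (q i - b i) \<le> C * \<delta>))"
  using assms
proof (induction J rule: finite_induct)
  case empty
  show ?case by (rule exI[of _ 0], intro conjI exI[of _ 1]) auto
next
  case (insert k J)
  obtain C s where C: "0 \<le> C" "0 < s" and IH: "\<And>\<delta> (b :: 'i \<Rightarrow> 'a). 0 \<le> \<delta> \<Longrightarrow> \<delta> \<le> s \<Longrightarrow>
    (\<forall>i\<in>J. \<forall>j\<in>J. \<bar>b i \<bullet> b j - (if i = j then 1 else 0)\<bar> \<le> \<delta>) \<Longrightarrow>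
    (\<exists>q. (\<forall>i\<in>J. \<forall>j\<in>J. q i \<bullet> q j = (if i = j then 1 else 0)) \<and>
         (\<forall>i\<in>J. norm (q i - b i) \<le> C * \<delta>))"
    using insert.IH by metis
  \<comment> \<open>Each of the \<open>card J\<close> components to be removed is at most \<open>\<delta> + 2 C \<delta>\<close>; the \<open>2\<close> bounds \<open>norm (b k)\<close>.\<close>
  define D where "D = card J * (1 + 2 * C)"
  have D: "0 \<le> D" using C by (simp add: D_def)
  \<comment> \<open>This threshold keeps the norm of the orthogonalized vector within \<open>1/2\<close> of \<open>1\<close>, so it can be normalized.\<close>
  define s' where "s' = min s (1 / (2 * (D + 1)))"
  have s': "0 < s'" using C D by (simp add: s'_def)
  have "\<exists>q. (\<forall>i\<in>insert k J. \<forall>j\<in>insert k J. q i \<bullet> q j = (if i = j then 1 else 0)) \<and>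
      (\<forall>i\<in>insert k J. norm (q i - b i) \<le> (C + 2 * D + 1) * \<delta>)"
    if \<delta>: "0 \<le> \<delta>" "\<delta> \<le> s'"
      and b: "\<forall>i\<in>insert k J. \<forall>j\<in>insert k J. \<bar>b i \<bullet> b j - (if i = j then 1 else 0)\<bar> \<le> \<delta>"
    for \<delta> and b :: "'i \<Rightarrow> 'a"
  proof -
    have \<delta>1: "(D + 1) * \<delta> \<le> 1/2"
    proof -
      have "(D + 1) * \<delta> \<le> (D + 1) * (1 / (2 * (D + 1)))"
        using \<delta> D by (intro mult_left_mono) (auto simp: s'_def)
      also have "\<dots> = 1/2" using D by (simp add: field_simps)
      finally show ?thesis .
    qed
    have \<delta>2: "\<delta> \<le> 1" using \<delta>1 mult_nonneg_nonneg[OF D \<delta>(1)] by (simp add: algebra_simps)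
    obtain q where q: "\<forall>i\<in>J. \<forall>j\<in>J. q i \<bullet> q j = (if i = j then 1 else 0)"
      and qb: "\<forall>i\<in>J. norm (q i - b i) \<le> C * \<delta>"
      using IH[of \<delta> b] \<delta> b by (auto simp: s'_def)
    have bk: "\<bar>(norm (b k))\<^sup>2 - 1\<bar> \<le> \<delta>" using b by (auto simp: power2_norm_eq_inner)
    have bk1: "\<bar>norm (b k) - 1\<bar> \<le> \<delta>"
    proof -
      have "(norm (b k))\<^sup>2 - 1 = (norm (b k) - 1) * (norm (b k) + 1)"
        by (simp add: power2_eq_square algebra_simps)
      then have "\<bar>(norm (b k))\<^sup>2 - 1\<bar> = \<bar>norm (b k) - 1\<bar> * (norm (b k) + 1)"
        by (simp add: abs_mult)
      moreover have "\<bar>norm (b k) - 1\<bar> * 1 \<le> \<bar>norm (b k) - 1\<bar> * (norm (b k) + 1)"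
        by (intro mult_left_mono) auto
      ultimately show ?thesis using bk by simp
    qed
    have bk2: "norm (b k) \<le> 2" using bk1 \<delta>2 by linarith
    define u where "u = b k - (\<Sum>i\<in>J. (b k \<bullet> q i) *\<^sub>R q i)"
    have nq: "norm (q i) = 1" if "i \<in> J" for i using q that by (simp add: norm_eq_sqrt_inner)
    have uq: "u \<bullet> q j = 0" if "j \<in> J" for j
    proof -
      have "(\<Sum>i\<in>J. (b k \<bullet> q i) * (q i \<bullet> q j)) = (\<Sum>i\<in>J. if i = j then b k \<bullet> q j else 0)"
        using q that by (intro sum.cong) auto
      also have "\<dots> = b k \<bullet> q j" using insert.hyps that by simp
      finally show ?thesis by (simp add: u_def inner_diff_left inner_sum_left)
    qed
    have ub: "norm (u - b k) \<le> D * \<delta>"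
    proof -
      have "norm (u - b k) \<le> (\<Sum>i\<in>J. norm ((b k \<bullet> q i) *\<^sub>R q i))"
        unfolding u_def by (simp add: norm_sum del: norm_scaleR)
      also have "\<dots> \<le> (\<Sum>i\<in>J. (1 + 2 * C) * \<delta>)"
      proof (intro sum_mono)
        fix i assume i: "i \<in> J"
        then have "k \<noteq> i" using insert.hyps by auto
        then have "\<bar>b k \<bullet> b i\<bar> \<le> \<delta>" using b[rule_format, of k i] i by auto
        moreover have "\<bar>b k \<bullet> (q i - b i)\<bar> \<le> 2 * (C * \<delta>)"
          using Cauchy_Schwarz_ineq2[of "b k" "q i - b i"] qb i bk2
            mult_mono[of "norm (b k)" 2 "norm (q i - b i)" "C * \<delta>"] by fastforce
        ultimately have "\<bar>b k \<bullet> q i\<bar> \<le> (1 + 2 * C) * \<delta>"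
          by (simp add: inner_diff_right algebra_simps)
        then show "norm ((b k \<bullet> q i) *\<^sub>R q i) \<le> (1 + 2 * C) * \<delta>" using nq[OF i] by simp
      qed
      finally show ?thesis by (simp add: D_def)
    qed
    have nu: "\<bar>norm u - 1\<bar> \<le> (D + 1) * \<delta>"
      using norm_triangle_ineq3[of u "b k"] ub bk1 by (simp add: algebra_simps)
    then have u0: "u \<noteq> 0" using \<delta>1 by auto
    define r where "r = u /\<^sub>R norm u"
    have rr: "r \<bullet> r = 1" using u0 by (simp add: r_def dot_square_norm power2_eq_square)
    have ru: "norm (r - u) = \<bar>norm u - 1\<bar>"
    proof -
      have "r - u = (inverse (norm u) - 1) *\<^sub>R u" by (simp add: r_def algebra_simps)
      then have "norm (r - u) = \<bar>inverse (norm u) - 1\<bar> * \<bar>norm u\<bar>" by simp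
      also have "\<dots> = \<bar>(inverse (norm u) - 1) * norm u\<bar>" by (simp add: abs_mult)
      also have "(inverse (norm u) - 1) * norm u = 1 - norm u" using u0 by (simp add: algebra_simps)
      finally show ?thesis by simp
    qed
    have rb: "norm (r - b k) \<le> (2 * D + 1) * \<delta>"
      using norm_triangle_ineq[of "r - u" "u - b k"] ru nu ub by (simp add: algebra_simps)
    have C1: "C * \<delta> \<le> (C + 2 * D + 1) * \<delta>" "(2 * D + 1) * \<delta> \<le> (C + 2 * D + 1) * \<delta>"
      using C D \<delta> by (auto intro!: mult_right_mono)
    have rq: "r \<bullet> q j = 0" "q j \<bullet> r = 0" if "j \<in> J" for j
      using uq[OF that] by (auto simp: r_def inner_commute)
    show ?thesis
    proof (intro exI[of _ "q(k := r)"] conjI ballI)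
      fix i j assume "i \<in> insert k J" "j \<in> insert k J"
      then show "(q(k := r)) i \<bullet> (q(k := r)) j = (if i = j then 1 else 0)"
        using q rq rr by auto
    next
      fix i assume "i \<in> insert k J"
      then show "norm ((q(k := r)) i - b i) \<le> (C + 2 * D + 1) * \<delta>"
        using qb rb C1 by fastforce
    qed
  qed
  note main = this
  show ?case
  proof (rule exI[of _ "C + 2 * D + 1"], intro conjI exI[of _ s'] allI impI)
    show "0 \<le> C + 2 * D + 1" using C D by simp
    show "0 < s'" by (rule s')
  qed (rule main)
qed

text \<open>
  Two families with nearly equal Gram matrices differ, up to a linear error, by an orthogonal map.
  Independence of the reference family \<open>u\<close> provides a linear map \<open>L\<close> with \<open>L (u k) = w k\<close>
  exactly; the hypothesis makes \<open>L\<close> nearly an isometry, and replacing the images of the standard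
  basis by nearby orthonormal vectors makes it one. Without independence only an error of order
  \<open>sqrt \<delta>\<close> could be expected: a vector \<open>w k\<close> with \<open>u k = 0\<close> may have length \<open>sqrt \<delta>\<close>.
\<close>
lemma orthogonal_map_of_near_gram:
  fixes u :: "'i \<Rightarrow> 'a::euclidean_space"
  assumes J: "finite J" and inj: "inj_on u J" and ind: "independent (u ` J)"
    and sp: "span (u ` J) = UNIV"
  shows "\<exists>C\<ge>0. \<exists>s>0. \<forall>\<delta> (w :: 'i \<Rightarrow> 'a). 0 \<le> \<delta> \<longrightarrow> \<delta> \<le> s \<longrightarrow>
    (\<forall>k\<in>J. \<forall>l\<in>J. \<bar>w k \<bullet> w l - u k \<bullet> u l\<bar> \<le> \<delta>) \<longrightarrow>
    (\<exists>f. orthogonal_transformation f \<and> (\<forall>k\<in>J. norm (w k - f (u k)) \<le> C * \<delta>))"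
proof -
  have "\<exists>c. e = (\<Sum>k\<in>J. c k *\<^sub>R u k)" for e
  proof -
    have "e \<in> span (u ` J)" using sp by simp
    then obtain a where "e = (\<Sum>v\<in>u ` J. a v *\<^sub>R v)" using J by (auto simp: span_finite)
    then show ?thesis by (auto simp: sum.reindex[OF inj] intro!: exI[of _ "a \<circ> u"])
  qed
  then obtain c where c: "\<And>e. e = (\<Sum>k\<in>J. c e k *\<^sub>R u k)" by metis
  \<comment> \<open>\<open>T\<^sup>2\<close> bounds how errors in the Gram matrix of \<open>u\<close> grow when passing to the standard basis.\<close>
  define T where "T = (\<Sum>e\<in>(Basis :: 'a set). \<Sum>k\<in>J. \<bar>c e k\<bar>)"
  have cT: "(\<Sum>k\<in>J. \<bar>c e k\<bar>) \<le> T" if "e \<in> Basis" for e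
    unfolding T_def by (rule member_le_sum[OF that]) (auto intro: sum_nonneg)
  have T: "0 \<le> T" unfolding T_def by (intro sum_nonneg) simp
  obtain C s where C: "0 \<le> C" "0 < s" and
    gs: "\<And>\<delta> (b :: 'a \<Rightarrow> 'a). 0 \<le> \<delta> \<Longrightarrow> \<delta> \<le> s \<Longrightarrow>
    (\<forall>i\<in>Basis. \<forall>j\<in>Basis. \<bar>b i \<bullet> b j - (if i = j then 1 else 0)\<bar> \<le> \<delta>) \<Longrightarrow>
    (\<exists>q. (\<forall>i\<in>Basis. \<forall>j\<in>Basis. q i \<bullet> q j = (if i = j then 1 else 0)) \<and>
         (\<forall>i\<in>Basis. norm (q i - b i) \<le> C * \<delta>))"
    using near_orthonormal_family[where 'i = 'a and 'a = 'a, OF finite_Basis] by metis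
  define U where "U = (\<Sum>k\<in>J. \<Sum>e\<in>Basis. \<bar>u k \<bullet> e\<bar>)"
  have U: "0 \<le> U" unfolding U_def by (intro sum_nonneg) simp
  have uU: "(\<Sum>e\<in>Basis. \<bar>u k \<bullet> e\<bar>) \<le> U" if "k \<in> J" for k
    unfolding U_def by (rule member_le_sum[OF that]) (auto intro: sum_nonneg J)
  have "\<exists>f. orthogonal_transformation f \<and> (\<forall>k\<in>J. norm (w k - f (u k)) \<le> (U * C * T\<^sup>2) * \<delta>)"
    if \<delta>: "0 \<le> \<delta>" "\<delta> \<le> s / (T\<^sup>2 + 1)"
      and w: "\<forall>k\<in>J. \<forall>l\<in>J. \<bar>w k \<bullet> w l - u k \<bullet> u l\<bar> \<le> \<delta>"
    for \<delta> and w :: "'i \<Rightarrow> 'a"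
  proof -
    obtain L where L: "linear L" "\<And>v. v \<in> u ` J \<Longrightarrow> L v = w (the_inv_into J u v)"
      using linear_independent_extend[OF ind, of "\<lambda>v. w (the_inv_into J u v)"] by blast
    have Lu: "L (u k) = w k" if "k \<in> J" for k
      using L(2)[of "u k"] that by (simp add: the_inv_into_f_f[OF inj])
    have Le: "L e = (\<Sum>k\<in>J. c e k *\<^sub>R w k)" for e
    proof -
      have "L e = L (\<Sum>k\<in>J. c e k *\<^sub>R u k)" using c[of e] by simp
      also have "\<dots> = (\<Sum>k\<in>J. c e k *\<^sub>R L (u k))"
        by (simp add: linear_sum[OF L(1)] linear_scale[OF L(1)])
      finally show ?thesis using Lu by simp
    qed
    have expand: "(\<Sum>k\<in>J. a k *\<^sub>R z k) \<bullet> (\<Sum>l\<in>J. a' l *\<^sub>R z l) = (\<Sum>k\<in>J. \<Sum>l\<in>J. a k * a' l * (z k \<bullet> z l))"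
      for a a' and z :: "'i \<Rightarrow> 'a"
      unfolding inner_sum_left by (simp add: inner_sum_right sum_distrib_left mult.assoc mult.left_commute)
    have gram: "\<bar>L e \<bullet> L e' - (if e = e' then 1 else 0)\<bar> \<le> T\<^sup>2 * \<delta>"
      if e: "e \<in> Basis" "e' \<in> Basis" for e e'
    proof -
      have "(if e = e' then 1 else 0) = e \<bullet> e'" using e by (simp add: inner_Basis)
      also have "\<dots> = (\<Sum>k\<in>J. \<Sum>l\<in>J. c e k * c e' l * (u k \<bullet> u l))"
        using expand[of "c e" u "c e'"] c[of e] c[of e'] by simp
      finally have "L e \<bullet> L e' - (if e = e' then 1 else 0) =
          (\<Sum>k\<in>J. \<Sum>l\<in>J. c e k * c e' l * (w k \<bullet> w l - u k \<bullet> u l))"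
        using expand[of "c e" w "c e'"] by (simp add: Le sum_subtractf right_diff_distrib)
      also have "\<bar>\<dots>\<bar> \<le> (\<Sum>k\<in>J. \<Sum>l\<in>J. \<bar>c e k * c e' l * (w k \<bullet> w l - u k \<bullet> u l)\<bar>)"
        by (intro order_trans[OF sum_abs] sum_mono sum_abs)
      also have "\<dots> \<le> (\<Sum>k\<in>J. \<Sum>l\<in>J. \<bar>c e k\<bar> * \<bar>c e' l\<bar> * \<delta>)"
        using w by (intro sum_mono) (simp add: abs_mult mult_left_mono)
      also have "\<dots> = (\<Sum>k\<in>J. \<bar>c e k\<bar>) * (\<Sum>l\<in>J. \<bar>c e' l\<bar>) * \<delta>"
        by (simp only: sum_product) (simp only: sum_distrib_right)
      also have "\<dots> \<le> T * T * \<delta>"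
        using cT e \<delta> T by (intro mult_right_mono mult_mono) (auto intro: sum_nonneg)
      finally show ?thesis by (simp add: power2_eq_square)
    qed
    have "T\<^sup>2 * \<delta> \<le> (T\<^sup>2 + 1) * (s / (T\<^sup>2 + 1))"
      using \<delta> by (intro mult_mono) auto
    also have "\<dots> = s" by (simp add: add_nonneg_eq_0_iff)
    finally have "T\<^sup>2 * \<delta> \<le> s" .
    then obtain q where q: "\<forall>i\<in>Basis. \<forall>j\<in>Basis. q i \<bullet> q j = (if i = j then 1 else 0)"
      and qL: "\<forall>i\<in>Basis. norm (q i - L i) \<le> C * (T\<^sup>2 * \<delta>)"
      using gs[of "T\<^sup>2 * \<delta>" L] gram \<delta> by auto
    \<comment> \<open>\<open>f\<close> is \<open>L\<close> with the images of the standard basis vectors replaced by \<open>q\<close>.\<close>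
    define f where "f z = (\<Sum>e\<in>Basis. (z \<bullet> e) *\<^sub>R q e)" for z
    have "linear f"
      by (rule linearI) (simp_all add: f_def inner_add_left scaleR_left_distrib sum.distrib scaleR_sum_right)
    moreover have "f v \<bullet> f z = v \<bullet> z" for v z
    proof -
      have "f v \<bullet> f z = (\<Sum>e\<in>Basis. \<Sum>e'\<in>Basis. (v \<bullet> e) * (z \<bullet> e') * (q e \<bullet> q e'))"
        unfolding f_def inner_sum_left by (simp add: inner_sum_right sum_distrib_left mult.assoc mult.left_commute)
      also have "\<dots> = (\<Sum>e\<in>Basis. \<Sum>e'\<in>Basis. if e = e' then (v \<bullet> e) * (z \<bullet> e') else 0)"
        using q by (intro sum.cong) auto
      also have "\<dots> = v \<bullet> z" by (simp add: euclidean_inner[of v z])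
      finally show ?thesis .
    qed
    ultimately have orth: "orthogonal_transformation f" by (simp add: orthogonal_transformation_def)
    have "norm (w k - f (u k)) \<le> (U * C * T\<^sup>2) * \<delta>" if k: "k \<in> J" for k
    proof -
      have "w k = L (\<Sum>e\<in>Basis. (u k \<bullet> e) *\<^sub>R e)" using Lu[OF k] by (simp add: euclidean_representation)
      also have "\<dots> = (\<Sum>e\<in>Basis. (u k \<bullet> e) *\<^sub>R L e)"
        by (simp add: linear_sum[OF L(1)] linear_scale[OF L(1)])
      finally have "w k - f (u k) = (\<Sum>e\<in>Basis. (u k \<bullet> e) *\<^sub>R (L e - q e))"
        by (simp add: f_def scaleR_diff_right sum_subtractf)
      also have "norm \<dots> \<le> (\<Sum>e\<in>Basis. norm ((u k \<bullet> e) *\<^sub>R (L e - q e)))" by (rule norm_sum)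
      also have "\<dots> \<le> (\<Sum>e\<in>Basis. \<bar>u k \<bullet> e\<bar> * (C * (T\<^sup>2 * \<delta>)))"
        using qL by (intro sum_mono) (auto intro!: mult_left_mono simp: norm_minus_commute)
      also have "\<dots> = (\<Sum>e\<in>Basis. \<bar>u k \<bullet> e\<bar>) * (C * (T\<^sup>2 * \<delta>))" by (simp add: sum_distrib_right)
      also have "\<dots> \<le> U * (C * (T\<^sup>2 * \<delta>))" using uU[OF k] C \<delta> by (intro mult_right_mono) auto
      finally show ?thesis by (simp add: mult.assoc)
    qed
    with orth show ?thesis by blast
  qed
  moreover have "0 \<le> U * C * T\<^sup>2" using U C by simp
  moreover have "0 < s / (T\<^sup>2 + 1)" using C by (simp add: add_nonneg_pos)
  ultimately show ?thesis by blast
qed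

section \<open>Affine frames and rigid transformations\<close>

lemma affine_spanning_differences:
  fixes x :: "'i \<Rightarrow> 'a::euclidean_space"
  assumes "affine hull (x ` I) = UNIV" and "i0 \<in> I"
  shows "span ((\<lambda>i. x i - x i0) ` (I - {i0})) = UNIV"
proof -
  have "(\<lambda>v. - x i0 + v) ` (x ` I - {x i0}) \<subseteq> (\<lambda>i. x i - x i0) ` (I - {i0})"
    by (auto simp: image_iff)
  then have "span ((\<lambda>v. - x i0 + v) ` (x ` I - {x i0})) \<subseteq> span ((\<lambda>i. x i - x i0) ` (I - {i0}))"
    by (rule span_mono)
  moreover have "(\<lambda>v. x i0 + v) ` span ((\<lambda>v. - x i0 + v) ` (x ` I - {x i0})) = UNIV"
    using affine_hull_span2[of "x i0" "x ` I"] assms by auto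
  then have "span ((\<lambda>v. - x i0 + v) ` (x ` I - {x i0})) = UNIV"
    by (auto simp: set_eq_iff image_iff) (metis add_left_cancel)
  ultimately show ?thesis by blast
qed

text \<open>
  The \<open>DIM('a)\<close> differences span, so there can be neither a repetition nor a linear relation
  among them.
\<close>
lemma affine_frame_differences:
  fixes x :: "'i \<Rightarrow> 'a::euclidean_space"
  assumes I: "finite I" "card I = DIM('a) + 1" and hull: "affine hull (x ` I) = UNIV" and i0: "i0 \<in> I"
  shows "inj_on (\<lambda>i. x i - x i0) (I - {i0})"
    and "independent ((\<lambda>i. x i - x i0) ` (I - {i0}))"
proof -
  let ?u = "\<lambda>i. x i - x i0" and ?J = "I - {i0}"
  have J: "finite ?J" "card ?J = DIM('a)" using I i0 by auto
  have sp: "span (?u ` ?J) = UNIV" using affine_spanning_differences[OF hull i0] .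
  have "DIM('a) \<le> card (?u ` ?J)"
    using dim_le_card'[of "?u ` ?J"] dim_span[of "?u ` ?J"] sp J by simp
  then have card: "card (?u ` ?J) = DIM('a)" using card_image_le[OF J(1), of ?u] J by simp
  then show "inj_on ?u ?J" using J by (simp add: eq_card_imp_inj_on)
  show "independent (?u ` ?J)"
    using card_eq_dim[of "?u ` ?J" UNIV] card J sp by simp
qed

lemma rigid_transformation_translation_orthogonal:
  assumes "orthogonal_transformation f"
  shows "rigid_transformation (\<lambda>z. a + f z)"
  using assms by (auto simp: rigid_transformation_def orthogonal_transformation_isometry)

lemma rigid_transformation_decompose:
  assumes "rigid_transformation g"
  obtains f where "orthogonal_transformation f" and "g = (\<lambda>z. g 0 + f z)"
proof
  show "orthogonal_transformation (\<lambda>z. g z - g 0)"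
    using assms by (simp add: rigid_transformation_def orthogonal_transformation_isometry dist_norm)
  show "g = (\<lambda>z. g 0 + (g z - g 0))" by simp
qed

lemma rigid_transformation_inverse:
  fixes g :: "real ^ 'p \<Rightarrow> real ^ 'p"
  assumes "rigid_transformation g"
  obtains h where "rigid_transformation h" and "\<And>z. g (h z) = z" and "\<And>z. h (g z) = z"
proof -
  obtain f where f: "orthogonal_transformation f" "g = (\<lambda>z. g 0 + f z)"
    using rigid_transformation_decompose[OF assms] .
  have "surj g"
  proof (rule surjI)
    fix z show "g (inv f (z - g 0)) = z"
      by (subst f(2)) (simp add: surj_f_inv_f[OF orthogonal_transformation_surj[OF f(1)]])
  qed
  moreover have "inj g"
    using assms by (metis injI rigid_transformation_def dist_eq_0_iff)
  ultimately have inv: "g (inv g z) = z" "inv g (g z) = z" for z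
    by (simp_all add: surj_f_inv_f)
  have "dist (inv g u) (inv g v) = dist u v" for u v
    using assms[unfolded rigid_transformation_def, rule_format, of "inv g u" "inv g v"]
    by (simp add: inv)
  then show ?thesis
    using that[of "inv g"] inv by (simp add: rigid_transformation_def)
qed

text \<open>
  A rigid transformation is a translation after an orthogonal map. The orthogonal maps form a compact
  set of bounded linear maps, and a translation longer than \<open>R\<close> already misplaces the first point
  by more than the total error of the identity, so the search may be confined to a compact set.
\<close>
lemma minimal_alignment_exists:
  fixes x y :: "nat \<Rightarrow> real ^ 'p"
  assumes "1 \<le> n"
  shows "\<exists>g. is_arg_min (alignment_error n x y) rigid_transformation g"
proof -
  let ?O = "{f :: (real ^ 'p) \<Rightarrow>\<^sub>L (real ^ 'p). \<forall>z. norm (blinfun_apply f z) = norm z}"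
  define F where "F = (\<lambda>(a, f :: (real ^ 'p) \<Rightarrow>\<^sub>L (real ^ 'p)). \<Sum>i\<in>{1..n}. (norm (y i - (a + blinfun_apply f (x i))))\<^sup>2)"
  \<comment> \<open>The final \<open>1\<close> makes the distance at the first point at least \<open>1\<close> for longer translations,
    so that its square still dominates the error of the identity.\<close>
  define R where "R = norm (y 1) + norm (x 1) + F (0, id_blinfun) + 1"
  have F0: "0 \<le> F af" for af unfolding F_def by (auto simp: case_prod_beta intro: sum_nonneg)
  have R: "0 \<le> R" using F0 by (simp add: R_def add_nonneg_nonneg)
  have "closed ?O"
  proof -
    have "?O = (\<Inter>z. {f. norm (blinfun_apply f z) = norm z})" by auto
    moreover have "closed \<dots>"
      by (intro closed_INT ballI closed_Collect_eq continuous_intros)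
    ultimately show ?thesis by simp
  qed
  moreover have "bounded ?O"
    by (rule boundedI[of _ 1]) (auto intro: norm_blinfun_bound)
  ultimately have "compact ?O" by (simp add: compact_eq_bounded_closed)
  then have cK: "compact (cball (0 :: real ^ 'p) R \<times> ?O)" by (intro compact_Times compact_cball)
  have id: "(0, id_blinfun) \<in> cball (0 :: real ^ 'p) R \<times> ?O" using R by simp
  have "continuous_on (cball 0 R \<times> ?O) F"
    unfolding F_def case_prod_beta by (intro continuous_intros)
  then obtain a0 f0 where af0: "(a0, f0) \<in> cball 0 R \<times> ?O"
    and min: "\<And>a f. (a, f) \<in> cball 0 R \<times> ?O \<Longrightarrow> F (a0, f0) \<le> F (a, f)"
    using continuous_attains_inf[OF cK, of F] id by fastforce
  let ?g = "\<lambda>z. a0 + blinfun_apply f0 z"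
  have orth: "orthogonal_transformation (blinfun_apply f)" if "f \<in> ?O" for f
    using that by (simp add: orthogonal_transformation blinfun.bounded_linear_right bounded_linear.linear)
  have "rigid_transformation ?g"
    using rigid_transformation_translation_orthogonal[OF orth] af0 by auto
  moreover have "alignment_error n x y ?g \<le> alignment_error n x y g" if g: "rigid_transformation g" for g
  proof -
    obtain f where f: "orthogonal_transformation f" "g = (\<lambda>z. g 0 + f z)"
      using rigid_transformation_decompose[OF g] .
    have "bounded_linear f" using f(1)
      by (simp add: orthogonal_transformation_def linear_conv_bounded_linear)
    then have Bf: "blinfun_apply (Blinfun f) = f" by (simp add: bounded_linear_Blinfun_apply)
    have O: "Blinfun f \<in> ?O" using f(1) by (simp add: Bf orthogonal_transformation)
    have eq: "alignment_error n x y g = F (g 0, Blinfun f)"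
      by (subst f(2)) (simp add: F_def alignment_error_def Bf)
    have eq0: "alignment_error n x y ?g = F (a0, f0)" by (simp add: F_def alignment_error_def)
    show ?thesis
    proof (cases "norm (g 0) \<le> R")
      case True
      then show ?thesis using min[of "g 0" "Blinfun f"] O eq eq0 by simp
    next
      case False
      let ?t = "norm (y 1 - (g 0 + f (x 1)))"
      have "norm (g 0) \<le> ?t + norm (y 1) + norm (f (x 1))"
        using norm_triangle_ineq4[of "y 1" "(y 1 - (g 0 + f (x 1))) + f (x 1)"]
          norm_triangle_ineq[of "y 1 - (g 0 + f (x 1))" "f (x 1)"] by (simp add: algebra_simps)
      moreover have "norm (f (x 1)) = norm (x 1)" using f(1) by (simp add: orthogonal_transformation)
      ultimately have t: "F (0, id_blinfun) + 1 \<le> ?t" using False by (simp add: R_def)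
      have "F (0, id_blinfun) \<le> ?t" "1 \<le> ?t" using t F0[of "(0, id_blinfun)"] by linarith+
      then have "F (0, id_blinfun) \<le> ?t\<^sup>2"
        using self_le_power[of ?t 2] by linarith
      also have "\<dots> \<le> F (g 0, Blinfun f)"
        using assms member_le_sum[of 1 "{1..n}" "\<lambda>i. (norm (y i - (g 0 + f (x i))))\<^sup>2"]
        by (simp add: F_def Bf)
      finally show ?thesis using min[of 0 id_blinfun] id eq eq0 by simp
    qed
  qed
  ultimately show ?thesis by (auto simp: is_arg_min_linorder)
qed

section \<open>Stability of lateration\<close>

text \<open>
  By polarization, nearly correct squared side lengths of a simplex give nearly correct inner products
  of the vectors from one vertex to the others, which is the situation of
  \<open>orthogonal_map_of_near_gram\<close>. The aligning map is stated as acting on \<open>y\<close> (rather than on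
  \<open>x\<close>) because the lateration step moves the perturbed points back to the fixed reference points
  \<open>x\<close>, whose geometry determines the constants.
\<close>
lemma base_simplex_alignment:
  fixes x :: "'i \<Rightarrow> real ^ 'p"
  assumes I: "finite I" "card I = CARD('p) + 1" and hull: "affine hull (x ` I) = UNIV"
  shows "\<exists>C\<ge>0. \<exists>s>0. \<forall>\<delta> (y :: 'i \<Rightarrow> real ^ 'p). 0 \<le> \<delta> \<longrightarrow> \<delta> \<le> s \<longrightarrow>
    (\<forall>i\<in>I. \<forall>j\<in>I. \<bar>(norm (y i - y j))\<^sup>2 - (norm (x i - x j))\<^sup>2\<bar> \<le> \<delta>) \<longrightarrow>
    (\<exists>g. rigid_transformation g \<and> (\<forall>i\<in>I. norm (g (y i) - x i) \<le> C * \<delta>))"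
proof -
  have "I \<noteq> {}" using I by auto
  then obtain i0 where i0: "i0 \<in> I" by blast
  let ?u = "\<lambda>i. x i - x i0" and ?J = "I - {i0}"
  have "finite ?J" using I by simp
  moreover have "card I = DIM(real ^ 'p) + 1" using I by simp
  ultimately obtain C s where C: "0 \<le> C" "0 < s" and
    al: "\<And>\<delta> (w :: 'i \<Rightarrow> real ^ 'p). 0 \<le> \<delta> \<Longrightarrow> \<delta> \<le> s \<Longrightarrow>
      (\<forall>k\<in>?J. \<forall>l\<in>?J. \<bar>w k \<bullet> w l - ?u k \<bullet> ?u l\<bar> \<le> \<delta>) \<Longrightarrow>
      (\<exists>f. orthogonal_transformation f \<and> (\<forall>k\<in>?J. norm (w k - f (?u k)) \<le> C * \<delta>))"
    using orthogonal_map_of_near_gram[of ?J ?u] affine_frame_differences[OF I(1) _ hull i0]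
      affine_spanning_differences[OF hull i0] by metis
  have "\<exists>g. rigid_transformation g \<and> (\<forall>i\<in>I. norm (g (y i) - x i) \<le> (2 * C) * \<delta>)"
    if \<delta>: "0 \<le> \<delta>" "\<delta> \<le> s / 2"
      and y: "\<forall>i\<in>I. \<forall>j\<in>I. \<bar>(norm (y i - y j))\<^sup>2 - (norm (x i - x j))\<^sup>2\<bar> \<le> \<delta>"
    for \<delta> and y :: "'i \<Rightarrow> real ^ 'p"
  proof -
    let ?w = "\<lambda>i. y i - y i0"
    have "\<bar>?w k \<bullet> ?w l - ?u k \<bullet> ?u l\<bar> \<le> 2 * \<delta>" if "k \<in> I" "l \<in> I" for k l
    proof -
      have pol: "2 * ((z k - z i0) \<bullet> (z l - z i0)) =
          (norm (z k - z i0))\<^sup>2 + (norm (z l - z i0))\<^sup>2 - (norm (z k - z l))\<^sup>2" for z :: "'i \<Rightarrow> real ^ 'p"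
        by (simp add: power2_norm_eq_inner inner_diff_left inner_diff_right inner_commute)
      show ?thesis using pol[of x] pol[of y] y[rule_format, of k i0] y[rule_format, of l i0]
          y[rule_format, of k l] that i0 \<delta> by linarith
    qed
    then obtain f where f: "orthogonal_transformation f"
      "\<forall>k\<in>?J. norm (?w k - f (?u k)) \<le> C * (2 * \<delta>)"
      using al[of "2 * \<delta>" ?w] \<delta> by auto
    have f': "norm (?w k - f (?u k)) \<le> (2 * C) * \<delta>" if "k \<in> I" for k
      using f that C \<delta> linear_0[OF orthogonal_transformation_linear[OF f(1)]]
      by (cases "k = i0") (auto simp: mult.assoc mult.left_commute[of C])
    define h where "h = (\<lambda>z. (y i0 - f (x i0)) + f z)"
    have h: "rigid_transformation h"
      unfolding h_def by (rule rigid_transformation_translation_orthogonal[OF f(1)])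
    obtain g where g: "rigid_transformation g" "\<And>z. g (h z) = z"
      using rigid_transformation_inverse[OF h] by metis
    have "norm (g (y k) - x k) \<le> (2 * C) * \<delta>" if "k \<in> I" for k
    proof -
      have "norm (g (y k) - x k) = dist (g (y k)) (g (h (x k)))" by (simp add: g dist_norm)
      also have "\<dots> = norm (y k - h (x k))" using g(1) by (simp add: rigid_transformation_def dist_norm)
      also have "y k - h (x k) = ?w k - f (?u k)"
        by (simp add: h_def linear_diff[OF orthogonal_transformation_linear[OF f(1)]])
      finally show ?thesis using f'[OF that] by simp
    qed
    with g show ?thesis by blast
  qed
  note main = this
  show ?thesis
  proof (rule exI[of _ "2 * C"], intro conjI exI[of _ "s / 2"] allI impI)
    show "0 \<le> 2 * C" "0 < s / 2" using C by simp_all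
  qed (rule main)
qed

text \<open>
  Replacing the anchors \<open>y i\<close> by \<open>x i\<close> changes the squared distances from \<open>z\<close> by
  \<open>O(\<delta>)\<close>, since \<open>z\<close> stays in a bounded region. So \<open>z\<close> and \<open>z0\<close> have nearly the same squared
  distances to the fixed anchors \<open>x i\<close>. In differences of two such equations the term
  \<open>(norm z)\<^sup>2\<close> cancels, leaving near-zero inner products of \<open>z - z0\<close> with the spanning vectors
  \<open>x i - x i0\<close>.
\<close>
lemma lateration_step:
  fixes x :: "'i \<Rightarrow> 'a::euclidean_space"
  assumes I: "finite I" and hull: "affine hull (x ` I) = UNIV" and C: "0 \<le> C"
  shows "\<exists>C'\<ge>0. \<forall>\<delta> y z. 0 \<le> \<delta> \<longrightarrow> \<delta> \<le> 1 \<longrightarrow>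
    (\<forall>i\<in>I. norm (y i - x i) \<le> C * \<delta> \<and> \<bar>(norm (z - y i))\<^sup>2 - (norm (z0 - x i))\<^sup>2\<bar> \<le> \<delta>) \<longrightarrow>
    norm (z - z0) \<le> C' * \<delta>"
proof -
  have "I \<noteq> {}" using hull by auto
  then obtain i0 where i0: "i0 \<in> I" by blast
  let ?S = "(\<lambda>i. x i - x i0) ` (I - {i0})"
  obtain K where K: "0 \<le> K" "\<And>z B. 0 \<le> B \<Longrightarrow> (\<forall>u\<in>?S. \<bar>z \<bullet> u\<bar> \<le> B) \<Longrightarrow> norm z \<le> K * B"
    using norm_le_of_inner_spanning[of ?S] affine_spanning_differences[OF hull i0] I by auto
  \<comment> \<open>\<open>R\<close> bounds the reference distances, so \<open>R + 1\<close> bounds the perturbed ones when \<open>\<delta> \<le> 1\<close>.\<close>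
  define R where "R = (\<Sum>i\<in>I. norm (z0 - x i))"
  have R: "0 \<le> R" unfolding R_def by (intro sum_nonneg) simp
  define D where "D = C * (C + 2 * (R + 1)) + 1"
  have D: "0 \<le> D" using C R by (simp add: D_def)
  have "norm (z - z0) \<le> (K * D) * \<delta>" if \<delta>: "0 \<le> \<delta>" "\<delta> \<le> 1"
    and y: "\<forall>i\<in>I. norm (y i - x i) \<le> C * \<delta> \<and> \<bar>(norm (z - y i))\<^sup>2 - (norm (z0 - x i))\<^sup>2\<bar> \<le> \<delta>"
    for \<delta> y z
  proof -
    have B: "\<bar>(norm (z - x i))\<^sup>2 - (norm (z0 - x i))\<^sup>2\<bar> \<le> D * \<delta>" if i: "i \<in> I" for i
    proof -
      have yi: "norm (y i - x i) \<le> C * \<delta>" "\<bar>(norm (z - y i))\<^sup>2 - (norm (z0 - x i))\<^sup>2\<bar> \<le> \<delta>"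
        using y i by auto
      have "norm (z0 - x i) \<le> R" unfolding R_def by (rule member_le_sum[OF i]) (auto intro: I)
      then have "(norm (z0 - x i))\<^sup>2 \<le> R\<^sup>2" by (simp add: power_mono)
      then have "(norm (z - y i))\<^sup>2 \<le> R\<^sup>2 + 1" using yi \<delta> by linarith
      also have "\<dots> \<le> (R + 1)\<^sup>2" using R by (simp add: power2_eq_square algebra_simps)
      finally have zy: "norm (z - y i) \<le> R + 1" by (rule power2_le_imp_le) (use R in simp)
      have diff: "\<bar>norm (z - x i) - norm (z - y i)\<bar> \<le> C * \<delta>"
        using norm_triangle_ineq3[of "z - x i" "z - y i"] yi by simp
      have "C * \<delta> \<le> C" using C \<delta> by (simp add: mult_left_le)
      with diff have "norm (z - x i) - norm (z - y i) \<le> C"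
        using abs_le_D1 order_trans by blast
      then have sum: "norm (z - x i) + norm (z - y i) \<le> C + 2 * (R + 1)" using zy by simp
      have "\<bar>(norm (z - x i))\<^sup>2 - (norm (z - y i))\<^sup>2\<bar> =
          \<bar>norm (z - x i) - norm (z - y i)\<bar> * (norm (z - x i) + norm (z - y i))"
        by (simp add: power2_eq_square square_diff_square_factored abs_mult)
      also have "\<dots> \<le> (C * \<delta>) * (C + 2 * (R + 1))"
        using diff sum C \<delta> by (intro mult_mono) auto
      finally show ?thesis using yi by (simp add: D_def algebra_simps)
    qed
    have "\<bar>(z - z0) \<bullet> (x i - x i0)\<bar> \<le> D * \<delta>" if i: "i \<in> I" for i
    proof -
      have "2 * ((z - z0) \<bullet> (x i - x i0)) =
          ((norm (z - x i0))\<^sup>2 - (norm (z0 - x i0))\<^sup>2) - ((norm (z - x i))\<^sup>2 - (norm (z0 - x i))\<^sup>2)"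
        by (simp add: power2_norm_eq_inner inner_diff_left inner_diff_right inner_commute)
      then show ?thesis using B[OF i] B[OF i0] by linarith
    qed
    then show ?thesis using K(2)[of "D * \<delta>" "z - z0"] D \<delta> by (auto simp: mult.assoc)
  qed
  note main = this
  show ?thesis
  proof (rule exI[of _ "K * D"], intro conjI allI impI)
    show "0 \<le> K * D" using K(1) D by simp
  qed (rule main)
qed

text \<open>
  Induction along the lateration ordering. The rigid transformation found for the base simplex is
  kept throughout; each new vertex only enlarges the constant \<open>C\<close>, while the threshold \<open>s\<close> (taken
  at most \<open>1\<close>, as the lateration step requires) does not change.
\<close>
lemma lateration_graph_alignment:
  fixes x :: "nat \<Rightarrow> real ^ 'p"
  assumes lat: "lateration_graph CARD('p) n E" and gp: "general_position n x"
  shows "\<exists>C\<ge>0. \<exists>s>0. \<forall>\<delta> (y :: nat \<Rightarrow> real ^ 'p). 0 \<le> \<delta> \<longrightarrow> \<delta> \<le> s \<longrightarrow>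
    (\<forall>i j. (i, j) \<in> E \<longrightarrow> \<bar>(norm (y i - y j))\<^sup>2 - (norm (x i - x j))\<^sup>2\<bar> \<le> \<delta>) \<longrightarrow>
    (\<exists>g. rigid_transformation g \<and> (\<forall>i\<in>{1..n}. norm (g (y i) - x i) \<le> C * \<delta>))"
proof -
  define near where "near = (\<lambda>\<delta> (y :: nat \<Rightarrow> real ^ 'p).
    \<forall>i j. (i, j) \<in> E \<longrightarrow> \<bar>(norm (y i - y j))\<^sup>2 - (norm (x i - x j))\<^sup>2\<bar> \<le> \<delta>)"
  obtain v where pn: "CARD('p) + 1 \<le> n" and v: "bij_betw v {1..n} {1..n}"
    and clique: "\<forall>i\<in>{1..CARD('p) + 1}. \<forall>j\<in>{1..CARD('p) + 1}. i \<noteq> j \<longrightarrow> (v i, v j) \<in> E"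
    and later: "\<forall>j\<in>{CARD('p) + 2..n}. CARD('p) + 1 \<le> card {u \<in> v ` {1..<j}. (u, v j) \<in> E}"
    using lat by (auto simp: lateration_graph_def)
  have inj: "inj_on v {1..n}" and im: "v ` {1..n} = {1..n}" using v by (auto simp: bij_betw_def)
  have "\<exists>C\<ge>0. \<exists>s>0. s \<le> 1 \<and> (\<forall>\<delta> y. 0 \<le> \<delta> \<longrightarrow> \<delta> \<le> s \<longrightarrow> near \<delta> y \<longrightarrow>
      (\<exists>g. rigid_transformation g \<and> (\<forall>i\<in>v ` {1..m}. norm (g (y i) - x i) \<le> C * \<delta>)))"
    if "CARD('p) + 1 \<le> m" "m \<le> n" for m
    using that
  proof (induction m rule: dec_induct)
    case base
    let ?I = "v ` {1..CARD('p) + 1}"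
    have I: "finite ?I" "card ?I = CARD('p) + 1" "?I \<subseteq> {1..n}"
      using card_image[OF inj_on_subset[OF inj]] pn im by (auto simp del: One_nat_def)
    then have hull: "affine hull (x ` ?I) = UNIV" using gp by (auto simp: general_position_def)
    obtain C s where C: "0 \<le> C" "0 < s" and al: "\<And>\<delta> (y :: nat \<Rightarrow> real ^ 'p). 0 \<le> \<delta> \<Longrightarrow> \<delta> \<le> s \<Longrightarrow>
      (\<forall>i\<in>?I. \<forall>j\<in>?I. \<bar>(norm (y i - y j))\<^sup>2 - (norm (x i - x j))\<^sup>2\<bar> \<le> \<delta>) \<Longrightarrow>
      (\<exists>g. rigid_transformation g \<and> (\<forall>i\<in>?I. norm (g (y i) - x i) \<le> C * \<delta>))"
      using base_simplex_alignment[OF I(1,2) hull] by metis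
    have "\<exists>g. rigid_transformation g \<and> (\<forall>i\<in>?I. norm (g (y i) - x i) \<le> C * \<delta>)"
      if \<delta>: "0 \<le> \<delta>" "\<delta> \<le> min s 1" "near \<delta> y" for \<delta> y
    proof (rule al)
      show "\<forall>i\<in>?I. \<forall>j\<in>?I. \<bar>(norm (y i - y j))\<^sup>2 - (norm (x i - x j))\<^sup>2\<bar> \<le> \<delta>"
      proof (intro ballI)
        fix i j assume "i \<in> ?I" "j \<in> ?I"
        then have "i = j \<or> (i, j) \<in> E" using clique by auto
        then show "\<bar>(norm (y i - y j))\<^sup>2 - (norm (x i - x j))\<^sup>2\<bar> \<le> \<delta>"
          using \<delta> by (auto simp: near_def)
      qed
    qed (use \<delta> in auto)
    note main = this
    show ?case
    proof (rule exI[of _ C], intro conjI exI[of _ "min s 1"] allI impI)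
      show "0 \<le> C" "0 < min s 1" "min s 1 \<le> 1" using C by simp_all
    qed (rule main)
  next
    case (step m)
    obtain C s where C: "0 \<le> C" "0 < s" "s \<le> 1" and al: "\<And>\<delta> y. 0 \<le> \<delta> \<Longrightarrow> \<delta> \<le> s \<Longrightarrow> near \<delta> y \<Longrightarrow>
      (\<exists>g. rigid_transformation g \<and> (\<forall>i\<in>v ` {1..m}. norm (g (y i) - x i) \<le> C * \<delta>))"
      using step.IH step.prems by (metis Suc_leD)
    let ?k = "v (Suc m)"
    have "Suc m \<in> {CARD('p) + 2..n}" using step by auto
    then have "CARD('p) + 1 \<le> card {u \<in> v ` {1..<Suc m}. (u, ?k) \<in> E}" using later by blast
    then obtain I where I: "I \<subseteq> {u \<in> v ` {1..<Suc m}. (u, ?k) \<in> E}" "card I = CARD('p) + 1" "finite I"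
      by (rule obtain_subset_with_card_n)
    have Iv: "I \<subseteq> v ` {1..m}" and IE: "\<And>i. i \<in> I \<Longrightarrow> (i, ?k) \<in> E"
      using I by (auto simp: atLeastLessThanSuc_atLeastAtMost)
    have "v ` {1..m} \<subseteq> {1..n}" using im step.prems by (metis Suc_leD atLeastatMost_subset_iff image_mono order_refl)
    then have "I \<subseteq> {1..n}" using Iv by blast
    then have hull: "affine hull (x ` I) = UNIV" using gp I by (auto simp: general_position_def)
    obtain C' where C': "0 \<le> C'" and st: "\<And>\<delta> y z. 0 \<le> \<delta> \<Longrightarrow> \<delta> \<le> 1 \<Longrightarrow>
      (\<forall>i\<in>I. norm (y i - x i) \<le> C * \<delta> \<and> \<bar>(norm (z - y i))\<^sup>2 - (norm (x ?k - x i))\<^sup>2\<bar> \<le> \<delta>) \<Longrightarrow>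
      norm (z - x ?k) \<le> C' * \<delta>"
      using lateration_step[OF I(3) hull C(1), of "x ?k"] by metis
    have "\<exists>g. rigid_transformation g \<and> (\<forall>i\<in>v ` {1..Suc m}. norm (g (y i) - x i) \<le> max C C' * \<delta>)"
      if \<delta>: "0 \<le> \<delta>" "\<delta> \<le> s" "near \<delta> y" for \<delta> y
    proof -
      obtain g where g: "rigid_transformation g" "\<forall>i\<in>v ` {1..m}. norm (g (y i) - x i) \<le> C * \<delta>"
        using al[OF \<delta>] by blast
      have "norm (g (y ?k) - x ?k) \<le> C' * \<delta>"
      proof (rule st[of \<delta> "\<lambda>i. g (y i)"])
        show "\<forall>i\<in>I. norm (g (y i) - x i) \<le> C * \<delta> \<and>
            \<bar>(norm (g (y ?k) - g (y i)))\<^sup>2 - (norm (x ?k - x i))\<^sup>2\<bar> \<le> \<delta>"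
        proof
          fix i assume i: "i \<in> I"
          \<comment> \<open>\<open>g\<close> preserves distances, so the edge condition for \<open>y\<close> carries over to its image.\<close>
          have "norm (g (y ?k) - g (y i)) = norm (y i - y ?k)"
            using g(1) by (metis rigid_transformation_def dist_norm norm_minus_commute)
          then show "norm (g (y i) - x i) \<le> C * \<delta> \<and>
              \<bar>(norm (g (y ?k) - g (y i)))\<^sup>2 - (norm (x ?k - x i))\<^sup>2\<bar> \<le> \<delta>"
            using g(2) i Iv IE[OF i] \<delta>(3) by (auto simp: near_def norm_minus_commute[of "x ?k"])
        qed
      qed (use \<delta> C in auto)
      moreover have "C * \<delta> \<le> max C C' * \<delta>" "C' * \<delta> \<le> max C C' * \<delta>"
        using \<delta> by (auto intro: mult_right_mono)
      ultimately have "\<forall>i\<in>v ` {1..Suc m}. norm (g (y i) - x i) \<le> max C C' * \<delta>"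
        using g(2) by (auto simp: atLeastAtMostSuc_conv intro: order_trans)
      then show ?thesis using g by blast
    qed
    note main = this
    show ?case
    proof (rule exI[of _ "max C C'"], intro conjI exI[of _ s] allI impI)
      show "0 \<le> max C C'" "0 < s" "s \<le> 1" using C C' by simp_all
    qed (rule main)
  qed
  from this[OF pn order_refl] show ?thesis
    unfolding im near_def by (elim exE conjE, intro exI conjI) assumption+
qed

section \<open>Minimizers of the stress\<close>

text \<open>
  The stress of \<open>x\<close> itself is \<open>\<Sum> \<epsilon>\<^sup>2\<close>, and each single residual of \<open>y\<close> is bounded by the total
  stress of \<open>y\<close>. The factor \<open>2\<close> comes from the triangle inequality through \<open>d\<^sup>2\<close>.
\<close>
lemma stress_minimizer_edge_lengths:
  fixes x y :: "nat \<Rightarrow> real ^ 'p"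
  assumes G: "simple_graph n E"
    and d: "\<forall>(i, j)\<in>E. (d i j)\<^sup>2 = (norm (x i - x j))\<^sup>2 + \<epsilon> i j"
    and min: "is_arg_min (stress E d) (\<lambda>_. True) y"
    and ij: "(i, j) \<in> E"
  shows "\<bar>(norm (y i - y j))\<^sup>2 - (norm (x i - x j))\<^sup>2\<bar> \<le> 2 * sqrt (\<Sum>(i, j)\<in>edges E. (\<epsilon> i j)\<^sup>2)"
proof -
  define \<eta> where "\<eta> = sqrt (\<Sum>(i, j)\<in>edges E. (\<epsilon> i j)\<^sup>2)"
  have "finite E" using G by (auto simp: simple_graph_def intro: finite_subset)
  then have fin: "finite (edges E)" by (rule rev_finite_subset) (auto simp: edges_def)
  have "stress E d y \<le> stress E d x" using min by (auto simp: is_arg_min_linorder)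
  also have "stress E d x = (\<Sum>(i, j)\<in>edges E. (\<epsilon> i j)\<^sup>2)"
    unfolding stress_def using d by (intro sum.cong) (auto simp: edges_def)
  finally have le: "stress E d y \<le> (\<Sum>(i, j)\<in>edges E. (\<epsilon> i j)\<^sup>2)" .
  have ordered: "\<bar>(norm (y k - y l))\<^sup>2 - (norm (x k - x l))\<^sup>2\<bar> \<le> 2 * \<eta>" if kl: "(k, l) \<in> edges E" for k l
  proof -
    have "((norm (y k - y l))\<^sup>2 - (d k l)\<^sup>2)\<^sup>2 \<le> stress E d y"
      unfolding stress_def
      using member_le_sum[OF kl, of "\<lambda>(i, j). ((norm (y i - y j))\<^sup>2 - (d i j)\<^sup>2)\<^sup>2"] fin by auto
    then have 1: "\<bar>(norm (y k - y l))\<^sup>2 - (d k l)\<^sup>2\<bar> \<le> \<eta>"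
      using le unfolding \<eta>_def by (intro real_le_rsqrt) simp
    have "(\<epsilon> k l)\<^sup>2 \<le> (\<Sum>(i, j)\<in>edges E. (\<epsilon> i j)\<^sup>2)"
      using member_le_sum[OF kl, of "\<lambda>(i, j). (\<epsilon> i j)\<^sup>2"] fin by auto
    then have 2: "\<bar>\<epsilon> k l\<bar> \<le> \<eta>" unfolding \<eta>_def by (intro real_le_rsqrt) simp
    have "(d k l)\<^sup>2 = (norm (x k - x l))\<^sup>2 + \<epsilon> k l" using d kl by (auto simp: edges_def)
    then show ?thesis using 1 2 by linarith
  qed
  have "(j, i) \<in> E" "i \<noteq> j" using G ij by (auto simp: simple_graph_def sym_def irrefl_def)
  then have "(i, j) \<in> edges E \<or> (j, i) \<in> edges E" using ij by (auto simp: edges_def)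
  then show ?thesis unfolding \<eta>_def[symmetric]
    using ordered[of i j] ordered[of j i] norm_minus_commute[of "y i"] norm_minus_commute[of "x i"] by metis
qed

theorem theorem3p1:
  fixes n :: nat
    and E :: "(nat \<times> nat) set"
    and x :: "nat \<Rightarrow> real ^ 'p"
  assumes "lateration_graph CARD('p) n E"
    and "general_position n x"
  shows "\<exists>\<sigma> > 0. \<exists>A > 0.
    \<forall>(d :: nat \<Rightarrow> nat \<Rightarrow> real) (\<epsilon> :: nat \<Rightarrow> nat \<Rightarrow> real).
      (\<forall>(i, j)\<in>E. 0 \<le> d i j \<and> d i j = d j i) \<longrightarrow>
      (\<forall>(i, j)\<in>E. (d i j)\<^sup>2 = (norm (x i - x j))\<^sup>2 + \<epsilon> i j) \<longrightarrow>
      (\<Sum>(i, j)\<in>edges E. (\<epsilon> i j)\<^sup>2) \<le> \<sigma>\<^sup>2 \<longrightarrow>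
      (\<forall>y :: nat \<Rightarrow> real ^ 'p.
        is_arg_min (stress E d) (\<lambda>_. True) y \<longrightarrow>
        (\<exists>g. is_arg_min (alignment_error n x y) rigid_transformation g \<and>
             alignment_error n x y g \<le> A * (\<Sum>(i, j)\<in>edges E. (\<epsilon> i j)\<^sup>2)))"
proof -
  have G: "simple_graph n E" and n: "1 \<le> n" using assms(1) by (auto simp: lateration_graph_def)
  obtain C s where C: "0 \<le> C" "0 < s" and al: "\<And>\<delta> (y :: nat \<Rightarrow> real ^ 'p). 0 \<le> \<delta> \<Longrightarrow> \<delta> \<le> s \<Longrightarrow>
    (\<forall>i j. (i, j) \<in> E \<longrightarrow> \<bar>(norm (y i - y j))\<^sup>2 - (norm (x i - x j))\<^sup>2\<bar> \<le> \<delta>) \<Longrightarrow>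
    (\<exists>g. rigid_transformation g \<and> (\<forall>i\<in>{1..n}. norm (g (y i) - x i) \<le> C * \<delta>))"
    using lateration_graph_alignment[OF assms] by metis
  \<comment> \<open>Each of the \<open>n\<close> points is off by at most \<open>2 C \<eta>\<close>; the summand \<open>1\<close> only ensures \<open>A > 0\<close>.\<close>
  define A where "A = 4 * n * C\<^sup>2 + 1"
  have A: "0 < A" by (simp add: A_def add_nonneg_pos)
  have "\<exists>g. is_arg_min (alignment_error n x y) rigid_transformation g \<and>
             alignment_error n x y g \<le> A * (\<Sum>(i, j)\<in>edges E. (\<epsilon> i j)\<^sup>2)"
    if d: "\<forall>(i, j)\<in>E. 0 \<le> d i j \<and> d i j = d j i"
      "\<forall>(i, j)\<in>E. (d i j)\<^sup>2 = (norm (x i - x j))\<^sup>2 + \<epsilon> i j"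
      and \<epsilon>: "(\<Sum>(i, j)\<in>edges E. (\<epsilon> i j)\<^sup>2) \<le> (s / 2)\<^sup>2"
      and y: "is_arg_min (stress E d) (\<lambda>_. True) y"
    for d \<epsilon> :: "nat \<Rightarrow> nat \<Rightarrow> real" and y :: "nat \<Rightarrow> real ^ 'p"
  proof -
    define Q where "Q = (\<Sum>(i, j)\<in>edges E. (\<epsilon> i j)\<^sup>2)"
    have Q: "0 \<le> Q" unfolding Q_def by (intro sum_nonneg) auto
    have "sqrt Q \<le> s / 2" using \<epsilon> C by (intro real_le_lsqrt) (auto simp: Q_def)
    moreover have lengths: "\<bar>(norm (y i - y j))\<^sup>2 - (norm (x i - x j))\<^sup>2\<bar> \<le> 2 * sqrt Q"
      if "(i, j) \<in> E" for i j
      unfolding Q_def by (rule stress_minimizer_edge_lengths[OF G d(2) y that])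
    ultimately obtain g where g: "rigid_transformation g" "\<forall>i\<in>{1..n}. norm (g (y i) - x i) \<le> C * (2 * sqrt Q)"
      using al[of "2 * sqrt Q" y] lengths Q by auto
    obtain h where h: "rigid_transformation h" "\<And>z. h (g z) = z"
      using rigid_transformation_inverse[OF g(1)] by metis
    have "alignment_error n x y h \<le> (\<Sum>i\<in>{1..n}. 4 * C\<^sup>2 * Q)"
      unfolding alignment_error_def
    proof (rule sum_mono)
      fix i assume i: "i \<in> {1..n}"
      have "norm (y i - h (x i)) = dist (h (g (y i))) (h (x i))" by (simp add: h dist_norm)
      also have "\<dots> = norm (g (y i) - x i)" using h(1) by (simp add: rigid_transformation_def dist_norm)
      finally have "norm (y i - h (x i)) \<le> C * (2 * sqrt Q)" using g i by simp
      then have "(norm (y i - h (x i)))\<^sup>2 \<le> (C * (2 * sqrt Q))\<^sup>2" by (simp add: power_mono)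
      then show "(norm (y i - h (x i)))\<^sup>2 \<le> 4 * C\<^sup>2 * Q" using Q by (simp add: power_mult_distrib)
    qed
    also have "\<dots> \<le> A * Q" using Q by (simp add: A_def algebra_simps)
    finally have hA: "alignment_error n x y h \<le> A * Q" .
    obtain g' where g': "is_arg_min (alignment_error n x y) rigid_transformation g'"
      using minimal_alignment_exists[OF n] by blast
    then have "alignment_error n x y g' \<le> alignment_error n x y h"
      using h(1) by (auto simp: is_arg_min_linorder)
    then show ?thesis using g' hA unfolding Q_def by auto
  qed
  note main = this
  show ?thesis
  proof (rule exI[of _ "s / 2"], intro conjI exI[of _ A] allI impI)
    show "0 < s / 2" "0 < A" using A C by simp_all
  qed (rule main)
qed

end
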